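(* A complete set of representatives for the orbit set $\mathcal{M}_n^2/\mathfrak{S}_n$ is $\{M_\pi : \pi\in\Pi_n\}$. That is, every $\mathfrak{S}_n$-orbit in $\mathcal{M}_n^2$ contains $M_\pi$ for exactly one $\pi\in\Pi_n$.
   Context: Let $n\ge 3$ be an integer and $[n]=\{1,\dots,n\}$. $\mathcal{M}_n^2$ is the set of matroids of rank $2$ on the ground set $[n]$ (a matroid is given by its set of bases $\mathcal{B}(M)\subset\binom{[n]}{2}$). The symmetric group $\mathfrak{S}_n$ acts on $\mathcal{M}_n^2$ by $\sigma([n],\mathcal{B})=([n],\sigma(\mathcal{B}))$. A partition is a finite multiset of positive integers, written $\pi=(k_1,\dots,k_\ell)$ with $k_1\ge\cdots\ge k_\ell\ge 1$; its weight is $w(\pi)=k_1+\cdots+k_\ell$ and its length is $\ell(\pi)=\ell$. $\Pi_n$ is the set of partitions of length at least $2$ and weight at most $n$. For $\pi=(k_1,\dots,k_\ell)\in\Pi_n$ let $P_i=\{k_{i+1}+\cdots+k_\ell+1,\dots,k_i+\cdots+k_\ell\}$ for $1\le i\le\ell$; these sets form a set partition of $\{1,\dots,w(\pi)\}$. $M_\pi$ is the rank $2$ matroid on $[n]$ whose bases are the sets $\{a,b\}$ with $a$ and $b$ lying in two distinct sets among $P_1,\dots,P_\ell$ (so its loops are $w(\pi)+1,\dots,n$). *)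

theory Defs
  imports
    "HOL-Library.Multiset"
    "HOL-Algebra.Group_Action"
    "HOL-Algebra.Sym_Groups"
begin

text \<open>A matroid is a pair of a finite ground set and its set of bases.\<close>

type_synonym 'a matroid = "'a set \<times> 'a set set"

definition is_matroid :: "'a matroid \<Rightarrow> bool" where
  "is_matroid M \<longleftrightarrow> (case M of (E, \<B>) \<Rightarrow>
     finite E \<and> \<B> \<subseteq> Pow E \<and> \<B> \<noteq> {} \<and>
     (\<forall>A\<in>\<B>. \<forall>B\<in>\<B>. \<forall>a\<in>A - B. \<exists>b\<in>B - A. insert b (A - {a}) \<in> \<B>))"

definition matroids_of_rank :: "nat \<Rightarrow> nat \<Rightarrow> nat matroid set" where
  "matroids_of_rank r n =
     {(E, \<B>). E = {1..n} \<and> is_matroid (E, \<B>) \<and> (\<forall>B\<in>\<B>. card B = r)}"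

text \<open>The restriction makes the action extensional, as \<^locale>\<open>group_action\<close> requires.\<close>

definition perm_action :: "nat \<Rightarrow> nat \<Rightarrow> (nat \<Rightarrow> nat) \<Rightarrow> nat matroid \<Rightarrow> nat matroid" where
  "perm_action r n \<sigma> = (\<lambda>(E, \<B>) \<in> matroids_of_rank r n. (E, (\<lambda>B. \<sigma> ` B) ` \<B>))"

definition weight :: "nat multiset \<Rightarrow> nat" where
  "weight \<pi> = \<Sum>\<^sub># \<pi>"

definition Partitions :: "nat \<Rightarrow> nat multiset set" where
  "Partitions n = {\<pi>. (\<forall>k\<in>#\<pi>. 0 < k) \<and> 2 \<le> size \<pi> \<and> weight \<pi> \<le> n}"

definition parts :: "nat multiset \<Rightarrow> nat list" where
  "parts \<pi> = rev (sorted_list_of_multiset \<pi>)"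

text \<open>
  \<^term>\<open>parts \<pi>\<close> lists the parts in decreasing order. Indices start at \<open>0\<close> here,
  so \<open>block \<pi> i\<close> is \<open>P\<close> with subscript \<open>i + 1\<close>.
\<close>

definition block :: "nat multiset \<Rightarrow> nat \<Rightarrow> nat set" where
  "block \<pi> i = {sum_list (drop (Suc i) (parts \<pi>)) + 1 .. sum_list (drop i (parts \<pi>))}"

definition M_part :: "nat \<Rightarrow> nat multiset \<Rightarrow> nat matroid" where
  "M_part n \<pi> = ({1..n},
     {{a, b} | a b. \<exists>i<size \<pi>. \<exists>j<size \<pi>. i \<noteq> j \<and> a \<in> block \<pi> i \<and> b \<in> block \<pi> j})"

lemma perm_image_matroid:
  assumes s: "\<sigma> permutes {1..n}" and M: "({1..n}, \<B>) \<in> matroids_of_rank r n"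
  shows "({1..n}, (\<lambda>B. \<sigma> ` B) ` \<B>) \<in> matroids_of_rank r n"
proof -
  have inj: "inj \<sigma>" using s by (rule permutes_inj)
  have m: "\<B> \<subseteq> Pow {1..n}" "\<B> \<noteq> {}" "\<forall>B\<in>\<B>. card B = r"
    and ex: "\<And>A B a. A \<in> \<B> \<Longrightarrow> B \<in> \<B> \<Longrightarrow> a \<in> A - B \<Longrightarrow> \<exists>b\<in>B - A. insert b (A - {a}) \<in> \<B>"
    using M by (auto simp: matroids_of_rank_def is_matroid_def)
  have "(\<lambda>B. \<sigma> ` B) ` \<B> \<subseteq> Pow {1..n}"
    using m(1) permutes_image[OF s] by blast
  moreover have "\<forall>B\<in>(\<lambda>B. \<sigma> ` B) ` \<B>. card B = r"
    using m(3) inj by (auto simp: card_image inj_on_subset)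
  moreover have "\<exists>b\<in>\<sigma> ` B - \<sigma> ` A. insert b (\<sigma> ` A - {a}) \<in> (\<lambda>B. \<sigma> ` B) ` \<B>"
    if AB: "A \<in> \<B>" "B \<in> \<B>" "a \<in> \<sigma> ` A - \<sigma> ` B" for A B a
  proof -
    obtain a' where a': "a = \<sigma> a'" "a' \<in> A - B" using AB(3) by blast
    obtain b where b: "b \<in> B - A" "insert b (A - {a'}) \<in> \<B>" using ex[OF AB(1,2) a'(2)] by blast
    have "\<sigma> b \<in> \<sigma> ` B - \<sigma> ` A" using b(1) inj by (auto dest: injD)
    moreover have "insert (\<sigma> b) (\<sigma> ` A - {a}) = \<sigma> ` insert b (A - {a'})"
      using inj by (simp add: image_set_diff a'(1))
    ultimately show ?thesis using b(2) by (metis image_eqI)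
  qed
  ultimately show ?thesis
    using m(2) unfolding matroids_of_rank_def is_matroid_def by auto
qed

lemma perm_action_group_action:
  "group_action (sym_group n) (matroids_of_rank r n) (perm_action r n)"
proof -
  let ?S = "matroids_of_rank r n"
  have fst_eq: "E = {1..n}" if "(E, \<B>) \<in> ?S" for E \<B>
    using that by (simp add: matroids_of_rank_def)
  have closed: "perm_action r n \<sigma> M \<in> ?S" if "\<sigma> permutes {1..n}" "M \<in> ?S" for \<sigma> M
  proof (cases M)
    case (Pair E \<B>)
    with that(2) have E: "E = {1..n}" using fst_eq by blast
    show ?thesis
      using perm_image_matroid[OF that(1), of \<B> r] that(2) unfolding Pair E
      by (simp add: perm_action_def)
  qed
  have comp: "perm_action r n \<sigma> (perm_action r n \<tau> M) = perm_action r n (\<sigma> \<circ> \<tau>) M"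
    if "\<tau> permutes {1..n}" "M \<in> ?S" for \<sigma> \<tau> M
    using that closed[OF that] by (cases M) (auto simp: perm_action_def image_image image_comp)
  have id: "perm_action r n id M = M" if "M \<in> ?S" for M
    using that by (cases M) (auto simp: perm_action_def)
  have bij: "perm_action r n \<sigma> \<in> Bij ?S" if s: "\<sigma> permutes {1..n}" for \<sigma>
  proof -
    have i: "inv' \<sigma> permutes {1..n}" using s by (rule permutes_inv)
    have "bij_betw (perm_action r n \<sigma>) ?S ?S"
      by (rule bij_betw_byWitness[where f' = "perm_action r n (inv' \<sigma>)"])
        (auto simp: comp[OF s] comp[OF i] permutes_inv_o[OF s] id closed[OF s] closed[OF i])
    then show ?thesis by (simp add: Bij_def perm_action_def)
  qed
  have "perm_action r n \<in> hom (sym_group n) (BijGroup ?S)"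
  proof (rule homI)
    fix \<sigma> assume "\<sigma> \<in> carrier (sym_group n)"
    then show "perm_action r n \<sigma> \<in> carrier (BijGroup ?S)"
      by (simp add: BijGroup_def bij sym_group_carrier)
  next
    fix \<sigma> \<tau> assume "\<sigma> \<in> carrier (sym_group n)" "\<tau> \<in> carrier (sym_group n)"
    then have s: "\<sigma> permutes {1..n}" and t: "\<tau> permutes {1..n}"
      by (simp_all add: sym_group_carrier)
    have "perm_action r n (\<sigma> \<circ> \<tau>) = compose ?S (perm_action r n \<sigma>) (perm_action r n \<tau>)"
    proof
      fix M
      show "perm_action r n (\<sigma> \<circ> \<tau>) M = compose ?S (perm_action r n \<sigma>) (perm_action r n \<tau>) M"
        by (cases "M \<in> ?S") (simp_all add: compose_def comp[OF t], simp add: perm_action_def)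
    qed
    then show "perm_action r n (\<sigma> \<otimes>\<^bsub>sym_group n\<^esub> \<tau>) =
        perm_action r n \<sigma> \<otimes>\<^bsub>BijGroup ?S\<^esub> perm_action r n \<tau>"
      using bij[OF s] bij[OF t] by (simp add: BijGroup_def sym_group_mult)
  qed
  then show ?thesis
    by (simp add: group_action_def group_hom_def group_hom_axioms_def sym_group_is_group
        group_BijGroup)
qed

end

theory Submission
  imports Defs "HOL-Library.Disjoint_Sets"
begin

text \<open>
  A rank \<open>2\<close> matroid is a complete multipartite graph together with isolated vertices: the bases
  are the edges, the isolated vertices are the loops, and the colour classes are the parallel
  classes. Indeed the exchange axiom says exactly that being parallel (being non-loops that do not
  form a basis) is transitive (lemma \<open>rank_two_bases_are_cross_pairs\<close>), and conversely
  any partition with two distinct blocks yields the bases of a matroid. The partition can be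
  recovered from the bases (lemma \<open>cross_pairs_inject\<close>), so rank \<open>2\<close> matroids on
  \<open>{1..n}\<close> correspond, compatibly with permutations, to partitions into at least two
  blocks of subsets of \<open>{1..n}\<close>.

  Under permutations of the finite ground set such a partition has a single invariant, the multiset
  of its block sizes: it is preserved, and if two partitions have the same block sizes, then
  a size-preserving matching of the blocks, bijections between matched blocks and any bijection
  between the two complements glue to a permutation carrying one to the other (lemma
  \<open>same_block_sizes_imp_conjugate\<close>). Since the blocks defining \<open>M_part n \<pi>\<close> have the multiset of sizes
  \<open>\<pi>\<close>, and the constraints on a multiset to be in \<open>Partitions n\<close> are precisely
  those on the block sizes of at least two disjoint nonempty subsets of \<open>{1..n}\<close>, every orbit
  contains exactly one \<open>M_part n \<pi>\<close>.
\<close>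

section \<open>Pairs of points from distinct blocks\<close>

definition cross_pairs :: "'a set set \<Rightarrow> 'a set set" where
  "cross_pairs P = {{a, b} | a b. \<exists>X\<in>P. \<exists>Y\<in>P. X \<noteq> Y \<and> a \<in> X \<and> b \<in> Y}"

definition block_sizes :: "'a set set \<Rightarrow> nat multiset" where
  "block_sizes P = image_mset card (mset_set P)"

lemma cross_pairsI:
  "X \<in> P \<Longrightarrow> Y \<in> P \<Longrightarrow> X \<noteq> Y \<Longrightarrow> a \<in> X \<Longrightarrow> b \<in> Y \<Longrightarrow> {a, b} \<in> cross_pairs P"
  unfolding cross_pairs_def by blast

lemma cross_pairsE:
  assumes "B \<in> cross_pairs P"
  obtains a b X Y where "B = {a, b}" "X \<in> P" "Y \<in> P" "X \<noteq> Y" "a \<in> X" "b \<in> Y"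
  using assms unfolding cross_pairs_def by blast

lemma partition_on_same_block:
  assumes "partition_on A P" "X \<in> P" "Y \<in> P" "a \<in> X" "a \<in> Y"
  shows "X = Y"
  using assms by (auto simp: partition_on_def disjoint_def)

lemma partition_on_remove_block:
  assumes P: "partition_on A P" and X: "X \<in> P"
  shows "partition_on (A - X) (P - {X})" "X \<subseteq> A"
proof -
  have "disjnt X (\<Union>(P - {X}))"
    unfolding disjnt_iff using partition_on_same_block[OF P X] by blast
  moreover have "insert X (P - {X}) = P" using X by blast
  ultimately show "partition_on (A - X) (P - {X})" "X \<subseteq> A"
    using partition_on_insert[of X "P - {X}" A] P by simp_all
qed

lemma doubleton_in_cross_pairs_iff:
  assumes P: "partition_on A P" and X: "X \<in> P" "a \<in> X"
  shows "{a, b} \<in> cross_pairs P \<longleftrightarrow> b \<in> A - X"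
proof
  assume "{a, b} \<in> cross_pairs P"
  then obtain c d Y Z where *: "{a, b} = {c, d}" "Y \<in> P" "Z \<in> P" "Y \<noteq> Z" "c \<in> Y" "d \<in> Z"
    by (rule cross_pairsE)
  have "b \<notin> X"
  proof
    assume "b \<in> X"
    then have "c \<in> X" "d \<in> X" using *(1) X(2) by (auto simp: doubleton_eq_iff)
    then show False using * X(1) partition_on_same_block[OF P] by metis
  qed
  moreover have "b \<in> Y \<union> Z" using * by (auto simp: doubleton_eq_iff)
  ultimately show "b \<in> A - X" using *(2,3) partition_onD1[OF P] by blast
next
  assume "b \<in> A - X"
  then show "{a, b} \<in> cross_pairs P"
    using partition_onD1[OF P] X by (auto intro: cross_pairsI)
qed

lemma card_cross_pair:
  assumes P: "partition_on A P" and B: "B \<in> cross_pairs P"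
  shows "card B = 2"
proof -
  obtain a b X Y where *: "B = {a, b}" "X \<in> P" "Y \<in> P" "X \<noteq> Y" "a \<in> X" "b \<in> Y"
    using B by (rule cross_pairsE)
  then have "a \<noteq> b" using partition_on_same_block[OF P] by blast
  then show ?thesis using * by simp
qed

lemma Union_cross_pairs:
  assumes P: "partition_on A P" and ne: "cross_pairs P \<noteq> {}"
  shows "\<Union>(cross_pairs P) = A"
proof
  show "\<Union>(cross_pairs P) \<subseteq> A"
    using partition_onD1[OF P] by (auto elim!: cross_pairsE)
  show "A \<subseteq> \<Union>(cross_pairs P)"
  proof
    fix a assume "a \<in> A"
    then obtain X where X: "X \<in> P" "a \<in> X" using partition_onD1[OF P] by blast
    obtain Y Z where "Y \<in> P" "Z \<in> P" "Y \<noteq> Z"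
      using ne unfolding cross_pairs_def by blast
    then obtain Y where Y: "Y \<in> P" "Y \<noteq> X" by blast
    then obtain b where "b \<in> Y" using partition_onD3[OF P] Y by (metis ex_in_conv)
    then have "{a, b} \<in> cross_pairs P" using X Y by (auto intro: cross_pairsI)
    then show "a \<in> \<Union>(cross_pairs P)" by blast
  qed
qed

text \<open>
  The block of a point consists of the points that form no pair with it. The assumption on
  nonemptiness excludes partitions with a single block, of which no pair keeps a trace.
\<close>

lemma cross_pairs_inject:
  assumes P: "partition_on A P" and Q: "partition_on A' Q"
    and eq: "cross_pairs P = cross_pairs Q" and ne: "cross_pairs P \<noteq> {}"
  shows "P = Q"
proof -
  have recover: "R = (\<lambda>a. {b \<in> C. {a, b} \<notin> cross_pairs R}) ` C" if R: "partition_on C R"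
    for C R
  proof -
    have *: "{b \<in> C. {a, b} \<notin> cross_pairs R} = X" if "X \<in> R" "a \<in> X" for a X
      using doubleton_in_cross_pairs_iff[OF R that] partition_onD1[OF R] that by auto
    have "X \<in> (\<lambda>a. {b \<in> C. {a, b} \<notin> cross_pairs R}) ` C" if X: "X \<in> R" for X
    proof -
      obtain a where "a \<in> X" using partition_onD3[OF R] X by (metis ex_in_conv)
      then show ?thesis using *[OF X, of a] X partition_onD1[OF R] by blast
    qed
    moreover have "{b \<in> C. {a, b} \<notin> cross_pairs R} \<in> R" if "a \<in> C" for a
      using * that partition_onD1[OF R] by auto
    ultimately show ?thesis by blast
  qed
  have "A = A'" using Union_cross_pairs[OF P] Union_cross_pairs[OF Q] eq ne by simp
  then show ?thesis using recover[OF P] recover[OF Q] eq by simp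
qed

lemma image_cross_pairs:
  assumes "inj \<sigma>"
  shows "(`) \<sigma> ` cross_pairs P = cross_pairs ((`) \<sigma> ` P)"
proof (intro equalityI subsetI)
  fix B assume "B \<in> (`) \<sigma> ` cross_pairs P"
  then obtain C where C: "B = \<sigma> ` C" "C \<in> cross_pairs P" by blast
  from C(2) obtain a b X Y where *: "C = {a, b}" "X \<in> P" "Y \<in> P" "X \<noteq> Y" "a \<in> X" "b \<in> Y"
    by (rule cross_pairsE)
  moreover have "\<sigma> ` X \<noteq> \<sigma> ` Y" using assms \<open>X \<noteq> Y\<close> by (simp add: inj_image_eq_iff)
  ultimately show "B \<in> cross_pairs ((`) \<sigma> ` P)"
    using C(1) cross_pairsI[of "\<sigma> ` X" "(`) \<sigma> ` P" "\<sigma> ` Y" "\<sigma> a" "\<sigma> b"] by simp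
next
  fix B assume "B \<in> cross_pairs ((`) \<sigma> ` P)"
  then obtain c d V W where *: "B = {c, d}" "V \<in> (`) \<sigma> ` P" "W \<in> (`) \<sigma> ` P" "V \<noteq> W"
    "c \<in> V" "d \<in> W"
    by (rule cross_pairsE)
  then obtain X Y where XY: "X \<in> P" "V = \<sigma> ` X" "Y \<in> P" "W = \<sigma> ` Y" by blast
  then obtain a b where ab: "a \<in> X" "c = \<sigma> a" "b \<in> Y" "d = \<sigma> b" using * by blast
  have "{a, b} \<in> cross_pairs P" using XY ab *(4) by (auto intro: cross_pairsI)
  moreover have "B = \<sigma> ` {a, b}" using *(1) ab by simp
  ultimately show "B \<in> (`) \<sigma> ` cross_pairs P" by blast
qed

lemma partition_on_image:
  assumes P: "partition_on A P" and "inj \<sigma>"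
  shows "partition_on (\<sigma> ` A) ((`) \<sigma> ` P)"
proof -
  have "{} \<notin> (`) \<sigma> ` P" using partition_onD3[OF P] by auto
  then show ?thesis
    using partition_on_inj_image[OF P, of \<sigma>] assms(2) by (simp add: inj_on_subset)
qed

section \<open>Rank two matroids are complete multipartite graphs\<close>

text \<open>
  Exchanging \<open>a\<close> out of \<open>{a, c}\<close> only requires a point outside the block of \<open>c\<close>, and the other basis
  cannot lie entirely in one block.
\<close>

lemma cross_pairs_in_matroids_of_rank_two:
  assumes P: "partition_on A P" and A: "A \<subseteq> {1..n}" and ne: "cross_pairs P \<noteq> {}"
  shows "({1..n}, cross_pairs P) \<in> matroids_of_rank 2 n"
proof -
  have exch: "\<exists>b\<in>B' - B. insert b (B - {a}) \<in> cross_pairs P"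
    if B: "B \<in> cross_pairs P" and B': "B' \<in> cross_pairs P" and a: "a \<in> B - B'" for B B' a
  proof -
    obtain c where c: "B = {a, c}" "a \<noteq> c"
      using card_cross_pair[OF P B] a by (auto simp: card_2_iff doubleton_eq_iff)
    have "c \<in> A" using B c Union_cross_pairs[OF P ne] by blast
    then obtain Z where Z: "Z \<in> P" "c \<in> Z" using partition_onD1[OF P] by blast
    obtain u v X Y where uv: "B' = {u, v}" "X \<in> P" "Y \<in> P" "X \<noteq> Y" "u \<in> X" "v \<in> Y"
      using B' by (rule cross_pairsE)
    have "u \<notin> Z \<or> v \<notin> Z"
      using uv Z(1) partition_on_same_block[OF P] by metis
    moreover have "u \<in> A" "v \<in> A" using uv partition_onD1[OF P] by blast+
    ultimately obtain b where b: "b \<in> B'" "b \<in> A - Z" using uv(1) by blast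
    then have "{c, b} \<in> cross_pairs P" using doubleton_in_cross_pairs_iff[OF P Z] by blast
    moreover have "insert b (B - {a}) = {c, b}" using c by auto
    moreover have "b \<in> B' - B" using b c Z a by auto
    ultimately show ?thesis by metis
  qed
  have "cross_pairs P \<subseteq> Pow {1..n}" using Union_cross_pairs[OF P ne] A by blast
  then show ?thesis
    using exch ne card_cross_pair[OF P] by (auto simp: matroids_of_rank_def is_matroid_def)
qed

text \<open>
  The blocks are the parallel classes. Exchange makes parallelism transitive: if \<open>{a, c}\<close> is a basis
  and \<open>b\<close> lies in some basis \<open>{b, d}\<close>, then either \<open>d\<close> is one of \<open>a\<close> and \<open>c\<close> or it can be exchanged
  for one of them, so \<open>b\<close> is not parallel to both.
\<close>

lemma rank_two_bases_are_cross_pairs: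
  assumes M: "({1..n}, \<B>) \<in> matroids_of_rank 2 n"
  obtains P where "partition_on (\<Union>\<B>) P" "\<B> = cross_pairs P"
proof
  define r where "r = {(a, b). a \<in> \<Union>\<B> \<and> b \<in> \<Union>\<B> \<and> {a, b} \<notin> \<B>}"
  have card2: "\<And>B. B \<in> \<B> \<Longrightarrow> card B = 2"
    and exch: "\<And>A B a. A \<in> \<B> \<Longrightarrow> B \<in> \<B> \<Longrightarrow> a \<in> A - B \<Longrightarrow> \<exists>b\<in>B - A. insert b (A - {a}) \<in> \<B>"
    using M by (auto simp: matroids_of_rank_def is_matroid_def)
  have distinct: "a \<noteq> b" if "{a, b} \<in> \<B>" for a b using card2[OF that] by auto
  have partner: "{a, b} \<in> \<B> \<or> {b, c} \<in> \<B>" if ac: "{a, c} \<in> \<B>" and b: "b \<in> \<Union>\<B>" for a b c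
  proof -
    obtain B where B: "B \<in> \<B>" "b \<in> B" using b by blast
    then obtain d where d: "B = {b, d}" "b \<noteq> d"
      using card2[OF B(1)] by (auto simp: card_2_iff doubleton_eq_iff)
    show ?thesis
    proof (cases "d \<in> {a, c}")
      case True
      then show ?thesis using B d by (auto simp: insert_commute)
    next
      case False
      then obtain x where "x \<in> {a, c}" "insert x (B - {d}) \<in> \<B>"
        using exch[OF B(1) ac, of d] d by blast
      moreover have "insert x (B - {d}) = {x, b}" using d by auto
      ultimately have "{x, b} \<in> \<B>" "x = a \<or> x = c" by simp_all
      then show ?thesis by (metis insert_commute)
    qed
  qed
  have equiv: "equiv (\<Union>\<B>) r"
  proof (rule equivI)
    show "r \<subseteq> \<Union>\<B> \<times> \<Union>\<B>" by (auto simp: r_def)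
    show "refl_on (\<Union>\<B>) r" using distinct unfolding r_def refl_on_def by blast
    show "sym r" unfolding r_def sym_def by (auto simp: insert_commute)
    show "trans r" using partner unfolding r_def trans_def by blast
  qed
  show part: "partition_on (\<Union>\<B>) (\<Union>\<B> // r)" by (rule partition_on_quotient[OF equiv])
  have iff: "{a, b} \<in> cross_pairs (\<Union>\<B> // r) \<longleftrightarrow> {a, b} \<in> \<B>" if "a \<in> \<Union>\<B>" for a b
  proof -
    have "r `` {a} \<in> \<Union>\<B> // r" "a \<in> r `` {a}"
      using quotientI[OF that] equiv_class_self[OF equiv that] by simp_all
    from doubleton_in_cross_pairs_iff[OF part this] show ?thesis
      using that by (auto simp: r_def)
  qed
  show "\<B> = cross_pairs (\<Union>\<B> // r)"
  proof (intro equalityI subsetI)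
    fix B assume B: "B \<in> \<B>"
    then obtain a b where "B = {a, b}" using card2[OF B] by (auto simp: card_2_iff)
    then show "B \<in> cross_pairs (\<Union>\<B> // r)" using iff B by blast
  next
    fix B assume B: "B \<in> cross_pairs (\<Union>\<B> // r)"
    then obtain a b X where *: "B = {a, b}" "X \<in> \<Union>\<B> // r" "a \<in> X" by (rule cross_pairsE)
    then have "a \<in> \<Union>\<B>" using partition_onD1[OF part] by blast
    then show "B \<in> \<B>" using iff B * by blast
  qed
qed

section \<open>Block sizes classify partitions up to permutation\<close>

lemma block_sizes_image:
  assumes "inj \<sigma>"
  shows "block_sizes ((`) \<sigma> ` P) = block_sizes P"
proof -
  have "inj_on ((`) \<sigma>) P" using assms by (simp add: inj_on_def inj_image_eq_iff)
  moreover have "card (\<sigma> ` X) = card X" for X using assms by (simp add: card_image inj_on_subset)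
  ultimately show ?thesis
    by (simp add: block_sizes_def multiset.map_comp comp_def flip: image_mset_mset_set)
qed

lemma finite_partition_on:
  assumes "partition_on A P" "finite A"
  shows "finite P" "\<And>X. X \<in> P \<Longrightarrow> finite X"
proof -
  show "finite P" using assms finite_elements by blast
  show "finite X" if "X \<in> P" for X
    using that assms partition_onD1[OF assms(1)] by (metis Sup_upper finite_subset)
qed

lemma sum_block_sizes:
  assumes P: "partition_on A P" and "finite A"
  shows "\<Sum>\<^sub># (block_sizes P) = card A"
  using product_partition[OF P] finite_partition_on[OF assms]
  by (simp add: block_sizes_def sum_unfold_sum_mset)

text \<open>
  Induction on the blocks: match a block of \<open>P\<close> with one of the same size in \<open>Q\<close>, remove both, and
  glue a bijection between them to the one for the remaining blocks.
\<close>

lemma same_block_sizes_imp_bij: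
  assumes "partition_on A P" "partition_on A' Q" "finite A" "finite A'"
    and "block_sizes P = block_sizes Q"
  shows "\<exists>g. bij_betw g A A' \<and> (`) g ` P = Q"
proof -
  have "finite P" using assms(1,3) finite_elements by blast
  then show ?thesis using assms
  proof (induction P arbitrary: A A' Q rule: finite_induct)
    case empty
    have "finite Q" using empty finite_elements by blast
    then have "Q = {}" using empty.prems by (simp add: block_sizes_def mset_set_empty_iff)
    then have "A = {}" "A' = {}" using empty.prems by (auto simp: partition_on_def)
    then show ?case using \<open>Q = {}\<close> by (simp add: bij_betw_def)
  next
    case (insert X P)
    note part = insert.prems(1,2) and fin = insert.prems(3,4) and sizes = insert.prems(5)
    have finQ: "finite Q" using finite_elements[OF fin(2) part(2)] .
    have "card X \<in># block_sizes Q"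
      using sizes insert.hyps by (metis block_sizes_def finite_insert insertI1
          elem_mset_set image_eqI set_image_mset)
    then obtain Y where Y: "Y \<in> Q" "card Y = card X"
      using finQ by (auto simp: block_sizes_def)
    have subX: "partition_on (A - X) P" "X \<subseteq> A"
      using partition_on_remove_block[OF part(1), of X] insert.hyps by simp_all
    have subY: "partition_on (A' - Y) (Q - {Y})" "Y \<subseteq> A'"
      using partition_on_remove_block[OF part(2) Y(1)] by simp_all
    have "block_sizes Q = add_mset (card Y) (block_sizes (Q - {Y}))"
      using finQ Y by (simp add: block_sizes_def mset_set.remove)
    moreover have "block_sizes (insert X P) = add_mset (card X) (block_sizes P)"
      using insert.hyps by (simp add: block_sizes_def)
    ultimately have "block_sizes P = block_sizes (Q - {Y})" using sizes Y by simp
    then obtain g where g: "bij_betw g (A - X) (A' - Y)" "(`) g ` P = Q - {Y}"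
      using insert.IH[OF subX(1) subY(1)] fin by auto
    obtain h where h: "bij_betw h X Y"
      using finite_same_card_bij[of X Y] Y subX subY fin by (metis finite_subset)
    let ?k = "\<lambda>a. if a \<in> X then h a else g a"
    have "bij_betw ?k (X \<union> (A - X)) (Y \<union> (A' - Y))"
      using bij_betw_disjoint_Un[OF h g(1)] by blast
    moreover have "X \<union> (A - X) = A" "Y \<union> (A' - Y) = A'" using subX subY by auto
    moreover have "?k ` X = Y" using h by (auto simp: bij_betw_def)
    moreover have "?k ` Z = g ` Z" if "Z \<in> P" for Z
    proof (rule image_cong[OF refl])
      fix a assume "a \<in> Z"
      then have "a \<notin> X" using that partition_onD1[OF subX(1)] by blast
      then show "?k a = g a" by simp
    qed
    then have "(`) ?k ` P = Q - {Y}" using g(2) by (metis (no_types, lifting) image_cong)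
    ultimately have "bij_betw ?k A A'" "(`) ?k ` insert X P = insert Y (Q - {Y})"
      by (simp_all only: image_insert)
    moreover have "insert Y (Q - {Y}) = Q" using Y(1) by blast
    ultimately show ?case by metis
  qed
qed

lemma bij_betw_extends_to_permutation:
  assumes "finite S" "A \<subseteq> S" "A' \<subseteq> S" and g: "bij_betw g A A'"
  obtains \<sigma> where "\<sigma> permutes S" "\<And>a. a \<in> A \<Longrightarrow> \<sigma> a = g a"
proof -
  have "card (S - A) = card (S - A')"
    using assms by (simp add: card_Diff_subset finite_subset bij_betw_same_card)
  then obtain h where h: "bij_betw h (S - A) (S - A')"
    using finite_same_card_bij[of "S - A" "S - A'"] assms(1) by auto
  let ?k = "\<lambda>a. if a \<in> A then g a else h a"
  have "bij_betw ?k (A \<union> (S - A)) (A' \<union> (S - A'))"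
    using bij_betw_disjoint_Un[OF g h] by blast
  moreover have "A \<union> (S - A) = S" "A' \<union> (S - A') = S" using assms by auto
  ultimately have "bij_betw ?k S S" by simp
  then have "restrict_id ?k S permutes S"
    by (intro bij_imp_permutes bij_betw_restrict_id) auto
  then show thesis using that[of "restrict_id ?k S"] assms(2)
    by (simp add: restrict_id_def subset_iff)
qed

lemma same_block_sizes_imp_conjugate:
  assumes P: "partition_on A P" "A \<subseteq> S" and Q: "partition_on A' Q" "A' \<subseteq> S"
    and S: "finite S" and sizes: "block_sizes P = block_sizes Q"
  obtains \<sigma> where "\<sigma> permutes S" "(`) \<sigma> ` P = Q"
proof -
  obtain g where g: "bij_betw g A A'" "(`) g ` P = Q"
    using same_block_sizes_imp_bij[OF P(1) Q(1)] P Q S sizes by (meson finite_subset)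
  obtain \<sigma> where \<sigma>: "\<sigma> permutes S" "\<And>a. a \<in> A \<Longrightarrow> \<sigma> a = g a"
    using bij_betw_extends_to_permutation[OF S P(2) Q(2) g(1)] by blast
  have "\<sigma> ` X = g ` X" if "X \<in> P" for X
    using that partition_onD1[OF P(1)] \<sigma>(2) by (intro image_cong) auto
  then have "(`) \<sigma> ` P = Q" using g(2) by auto
  then show thesis using that \<sigma>(1) by blast
qed

section \<open>The blocks of an integer partition\<close>

text \<open>
  Intervals are stacked from the last list entry upwards, so prepending an entry leaves the earlier
  intervals in place and adds a new one on top; this makes induction on the list work.
\<close>

lemma stacked_intervals:
  fixes xs :: "nat list"
  assumes "\<forall>x\<in>set xs. 0 < x"
  defines "I \<equiv> \<lambda>xs i. {sum_list (drop (Suc i) xs) + 1 .. sum_list (drop i xs)}"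
  shows "partition_on {1..sum_list xs} (I xs ` {..<length xs}) \<and> inj_on (I xs) {..<length xs}
    \<and> block_sizes (I xs ` {..<length xs}) = mset xs"
  using assms(1)
proof (induction xs)
  case Nil
  then show ?case by (simp add: partition_on_def block_sizes_def)
next
  case (Cons x xs)
  let ?s = "sum_list xs" and ?P = "I xs ` {..<length xs}"
  let ?X = "{?s + 1 .. ?s + x}"
  have IH: "partition_on {1..?s} ?P" "inj_on (I xs) {..<length xs}" "block_sizes ?P = mset xs"
    using Cons by simp_all
  have I0: "I (x # xs) 0 = ?X" and ISuc: "I (x # xs) (Suc i) = I xs i" for i
    by (auto simp: I_def add.commute)
  have index: "{..<length (x # xs)} = insert 0 (Suc ` {..<length xs})"
    by (simp add: lessThan_Suc_eq_insert_0)
  have P: "I (x # xs) ` {..<length (x # xs)} = insert ?X ?P"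
    unfolding index by (simp add: I0 ISuc image_image)
  have Un: "\<Union>?P = {1..?s}" using partition_onD1[OF IH(1)] by simp
  have ne: "?X \<noteq> {}" using Cons.prems by auto
  have disj: "disjnt ?X (\<Union>?P)" unfolding Un by (auto simp: disjnt_def)
  have new: "?X \<notin> ?P"
  proof
    assume "?X \<in> ?P"
    then have "?X \<subseteq> \<Union>?P" by (rule Union_upper)
    then show False using disj ne unfolding disjnt_def by blast
  qed
  have "{1..sum_list (x # xs)} - ?X = {1..?s}" by auto
  then have "partition_on {1..sum_list (x # xs)} (insert ?X ?P)"
    using partition_on_insert[OF disj] IH(1) ne by auto
  moreover have "inj_on (I (x # xs)) {..<length (x # xs)}"
    unfolding index using IH(2) new by (auto simp: inj_on_def I0 ISuc)
  moreover have "block_sizes (insert ?X ?P) = mset (x # xs)"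
    using IH(3) new by (simp add: block_sizes_def)
  ultimately show ?case unfolding P by blast
qed

definition blocks :: "nat multiset \<Rightarrow> nat set set" where
  "blocks \<pi> = block \<pi> ` {..<size \<pi>}"

lemma blocks_of_Partitions:
  assumes "\<pi> \<in> Partitions n"
  shows "partition_on {1..weight \<pi>} (blocks \<pi>)" "block_sizes (blocks \<pi>) = \<pi>"
    "M_part n \<pi> = ({1..n}, cross_pairs (blocks \<pi>))" "cross_pairs (blocks \<pi>) \<noteq> {}"
proof -
  have mset: "mset (parts \<pi>) = \<pi>" by (simp add: parts_def)
  then have len: "length (parts \<pi>) = size \<pi>" and sum: "sum_list (parts \<pi>) = weight \<pi>"
    by (metis size_mset, metis weight_def sum_mset_sum_list)
  have "\<forall>x\<in>set (parts \<pi>). 0 < x"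
    using assms mset by (metis (no_types, lifting) Partitions_def mem_Collect_eq set_mset_mset)
  from stacked_intervals[OF this]
  have inj: "inj_on (block \<pi>) {..<size \<pi>}"
    and *: "partition_on {1..weight \<pi>} (blocks \<pi>)" "block_sizes (blocks \<pi>) = \<pi>"
    unfolding blocks_def block_def len sum mset by simp_all
  show "partition_on {1..weight \<pi>} (blocks \<pi>)" "block_sizes (blocks \<pi>) = \<pi>" by (fact *)+
  have neq: "i \<noteq> j \<longleftrightarrow> block \<pi> i \<noteq> block \<pi> j" if "i < size \<pi>" "j < size \<pi>" for i j
    using inj that by (auto simp: inj_on_def)
  show "M_part n \<pi> = ({1..n}, cross_pairs (blocks \<pi>))"
    unfolding M_part_def cross_pairs_def blocks_def using neq by fastforce
  have lt: "0 < size \<pi>" "1 < size \<pi>" using assms by (auto simp: Partitions_def)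
  then have "block \<pi> 0 \<in> blocks \<pi>" "block \<pi> 1 \<in> blocks \<pi>" "block \<pi> 0 \<noteq> block \<pi> 1"
    using neq[OF lt] by (auto simp: blocks_def)
  moreover obtain a b where "a \<in> block \<pi> 0" "b \<in> block \<pi> 1"
    using calculation partition_onD3[OF *(1)] by (metis ex_in_conv)
  ultimately have "{a, b} \<in> cross_pairs (blocks \<pi>)" by (rule cross_pairsI)
  then show "cross_pairs (blocks \<pi>) \<noteq> {}" by blast
qed

lemma block_sizes_in_Partitions:
  assumes P: "partition_on A P" and A: "A \<subseteq> {1..n}" and ne: "cross_pairs P \<noteq> {}"
  shows "block_sizes P \<in> Partitions n"
proof -
  have finA: "finite A" using A finite_subset by blast
  note fin = finite_partition_on[OF P finA]
  have "\<forall>k\<in>#block_sizes P. 0 < k"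
    using fin partition_onD3[OF P] by (auto simp: block_sizes_def card_gt_0_iff)
  moreover obtain X Y where "X \<in> P" "Y \<in> P" "X \<noteq> Y"
    using ne unfolding cross_pairs_def by blast
  then have "2 \<le> card P" using fin(1) card_mono[of P "{X, Y}"] by simp
  then have "2 \<le> size (block_sizes P)" by (simp add: block_sizes_def)
  moreover have "weight (block_sizes P) \<le> n"
    using sum_block_sizes[OF P finA] card_mono[OF _ A] by (simp add: weight_def)
  ultimately show ?thesis by (simp add: Partitions_def)
qed

section \<open>Orbits of rank two matroids\<close>

theorem theorem4p6:
  fixes n :: nat
  assumes "n \<ge> 3"
  shows "M_part n ` Partitions n \<subseteq> matroids_of_rank 2 n \<and>
    (\<forall>\<O> \<in> orbits (sym_group n) (matroids_of_rank 2 n) (perm_action 2 n).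
       \<exists>!\<pi>. \<pi> \<in> Partitions n \<and> M_part n \<pi> \<in> \<O>)"
proof (intro conjI ballI)
  have in_range: "{1..weight \<pi>} \<subseteq> {1..n}" if "\<pi> \<in> Partitions n" for \<pi>
    using that by (auto simp: Partitions_def)
  show "M_part n ` Partitions n \<subseteq> matroids_of_rank 2 n"
  proof (rule image_subsetI)
    fix \<pi> assume \<pi>: "\<pi> \<in> Partitions n"
    note bl = blocks_of_Partitions[OF \<pi>]
    show "M_part n \<pi> \<in> matroids_of_rank 2 n"
      unfolding bl(3) by (rule cross_pairs_in_matroids_of_rank_two[OF bl(1) in_range[OF \<pi>] bl(4)])
  qed
  fix \<O> assume "\<O> \<in> orbits (sym_group n) (matroids_of_rank 2 n) (perm_action 2 n)"
  then obtain M where M: "M \<in> matroids_of_rank 2 n"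
    and \<O>: "\<O> = {perm_action 2 n \<sigma> M | \<sigma>. \<sigma> permutes {1..n}}"
    by (auto simp: orbits_def orbit_def sym_group_carrier)
  obtain \<B> where \<B>: "M = ({1..n}, \<B>)" "\<B> \<noteq> {}" "\<Union>\<B> \<subseteq> {1..n}"
    using M by (auto simp: matroids_of_rank_def is_matroid_def)
  obtain P where P: "partition_on (\<Union>\<B>) P" "\<B> = cross_pairs P"
    using rank_two_bases_are_cross_pairs M \<B>(1) by blast
  have ne: "cross_pairs P \<noteq> {}" using P \<B> by simp
  have act: "perm_action 2 n \<sigma> M = ({1..n}, cross_pairs ((`) \<sigma> ` P))" if "\<sigma> permutes {1..n}" for \<sigma>
    using M image_cross_pairs[OF permutes_inj[OF that], of P]
    by (simp add: perm_action_def \<B>(1) P(2))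
  show "\<exists>!\<pi>. \<pi> \<in> Partitions n \<and> M_part n \<pi> \<in> \<O>"
  proof (intro ex1I[of _ "block_sizes P"] conjI)
    show \<pi>: "block_sizes P \<in> Partitions n"
      by (rule block_sizes_in_Partitions[OF P(1) \<B>(3) ne])
    note bl = blocks_of_Partitions[OF \<pi>]
    obtain \<sigma> where "\<sigma> permutes {1..n}" "(`) \<sigma> ` P = blocks (block_sizes P)"
      using same_block_sizes_imp_conjugate[OF P(1) \<B>(3) bl(1) in_range[OF \<pi>]] bl(2) by auto
    then show "M_part n (block_sizes P) \<in> \<O>"
      unfolding \<O> bl(3) using act by (metis (mono_tags, lifting) mem_Collect_eq)
  next
    fix \<pi> assume *: "\<pi> \<in> Partitions n \<and> M_part n \<pi> \<in> \<O>"
    then have \<pi>: "\<pi> \<in> Partitions n" by blast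
    note bl = blocks_of_Partitions[OF \<pi>]
    obtain \<sigma> where \<sigma>: "\<sigma> permutes {1..n}" "M_part n \<pi> = perm_action 2 n \<sigma> M"
      using * by (auto simp: \<O>)
    have inj: "inj \<sigma>" using \<sigma>(1) by (rule permutes_inj)
    have "cross_pairs (blocks \<pi>) = cross_pairs ((`) \<sigma> ` P)" using \<sigma> act bl(3) by simp
    then have "blocks \<pi> = (`) \<sigma> ` P"
      using cross_pairs_inject[OF bl(1) partition_on_image[OF P(1) inj]] bl(4) by blast
    then show "\<pi> = block_sizes P" using bl(2) block_sizes_image[OF inj] by metis
  qed
qed

end
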